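(* The optimization problems PADP-FS and PADP-FS2SD defined in the context are equivalent, in the following sense. From every optimal solution $(\boldsymbol{f},\Lambda,\boldsymbol{p},\boldsymbol{s},\boldsymbol{x})$ of PADP-FS one obtains, with the same values of $\boldsymbol{f},\Lambda,\boldsymbol{p},\boldsymbol{s},\boldsymbol{x}$ and some $\boldsymbol{w}$, a feasible solution of PADP-FS2SD (i.e. $(\boldsymbol{f},\Lambda)\in\mathcal{F}\times\mathcal{L}$ and $(\boldsymbol{x},\boldsymbol{s},\boldsymbol{w},\boldsymbol{p})\in\mathcal{S}(\boldsymbol{f},\Lambda)$) with the same objective value. Conversely, from every optimal solution of PADP-FS2SD, i.e. an optimal $(\boldsymbol{f},\Lambda)$ together with an optimal second-stage solution $(\boldsymbol{x},\boldsymbol{s},\boldsymbol{w},\boldsymbol{p})\in\mathcal{S}(\boldsymbol{f},\Lambda)$, the tuple $(\boldsymbol{f},\Lambda,\boldsymbol{p},\boldsymbol{s},\boldsymbol{x})$ is a feasible solution of PADP-FS with the same objective value. In particular the two problems have the same optimal value.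
   Context: **Data.** Finite sets: operators $\mathcal{O}$, routes $\mathcal{R}$, discount activation categories $\mathcal{A}$, passenger types $\mathcal{N}$, time intervals $\mathcal{T}$. Route $r$ is served by the operators in $\mathcal{O}_r\subseteq\mathcal{O}$; $\Delta_{rk}\ge 0$ is the distance of route $r$ covered by operator $k$; $c_k\ge 0$ is operator $k$'s marginal cost per unit distance per passenger. $\mathcal{R}^D\subseteq\mathcal{R}$ is the set of discount-eligible routes, partitioned into disjoint sets $\mathcal{R}_a^D$, $a\in\mathcal{A}$. Passenger type $i$ has route options $\mathcal{R}_i\subseteq\mathcal{R}$; $\mathcal{N}_a\subseteq\mathcal{N}$ is the set of types $i$ with $\mathcal{R}_i\cap\mathcal{R}_a^D\neq\emptyset$. $N_{it}\ge 0$ is the number of passengers of type $i$ at time $t$; $u_{irt}\in\mathbb{R}$ is the non-monetary utility of route $r$; $u_{i0t}\in\mathbb{R}$ is the utility of the outside option (driving); $\alpha_i<0$ is the utility per unit price; $\Delta_i^0\geq 0$ is the driving distance under the outside option. Weights $\pi^{PX},\pi^{PR},\pi^{VM}\ge 0$. Bounds $B,M\ge 0$ and $0\le L\le 1$. **PADP-FS.** Variables $\boldsymbol{f}=(\boldsymbol\beta,\boldsymbol\mu)$ (fare parameters: base fares $\beta_k$ and markups $\mu_k$, $k\in\mathcal{O}$), discount multiplier $\Lambda$, prices $p_r$ ($r\in\mathcal{R}$), market shares $s_{irt}$ ($i\in\mathcal{N},r\in\mathcal{R}_i,t\in\mathcal{T}$) and $s_{i0t}$, and discount activations $x_a$. Maximize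 $$\sum_{t\in\mathcal{T}}\sum_{i\in\mathcal{N}}N_{it}\Big(\pi^{PX}\big(u_{i0t}+\sum_{r\in\mathcal{R}_i}(u_{irt}+\alpha_ip_r)\big)+\pi^{PR}\sum_{r\in\mathcal{R}_i}\big(p_r-\sum_{k\in\mathcal{O}_r}c_k\Delta_{rk}\big)s_{irt}-\pi^{VM}\Delta_i^0s_{i0t}\Big)$$ subject to - $p_r=\sum_{k\in\mathcal{O}_r}(\beta_k+\mu_k\Delta_{rk})$ for $r\in\mathcal{R}\setminus\mathcal{R}^D$; - $p_r=(1-\Lambda x_a)\sum_{k\in\mathcal{O}_r}(\beta_k+\mu_k\Delta_{rk})$ for $a\in\mathcal{A}$, $r\in\mathcal{R}_a^D$; - $s_{irt}=\dfrac{e^{u_{irt}+\alpha_ip_r}}{e^{u_{i0t}}+\sum_{q\in\mathcal{R}_i}e^{u_{iqt}+\alpha_ip_q}}$ and $s_{i0t}=\dfrac{e^{u_{i0t}}}{e^{u_{i0t}}+\sum_{q\in\mathcal{R}_i}e^{u_{iqt}+\alpha_ip_q}}$ for all $i\in\mathcal{N}$, $r\in\mathcal{R}_i$, $t\in\mathcal{T}$; - $0\le\beta_k\le B$, $c_k\le\mu_k\le M$ for $k\in\mathcal{O}$; $0\le\Lambda\le L$; $x_a\in\{0,1\}$ for $a\in\mathcal{A}$. **PADP-FS2SD.** Let $\mathcal{F}=\{(\boldsymbol\beta,\boldsymbol\mu):0\le\beta_k\le B,\ c_k\le\mu_k\le M\ \forall k\in\mathcal{O}\}$ and $\mathcal{L}=[0,L]$.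 For $(\hat{\boldsymbol f},\hat\Lambda)\in\mathcal{F}\times\mathcal{L}$ with $\hat{\boldsymbol f}=(\hat{\boldsymbol\beta},\hat{\boldsymbol\mu})$ put $$\sigma_r=\sum_{k\in\mathcal{O}_r}(\hat\beta_k+\hat\mu_k\Delta_{rk}),\quad \kappa_r=\sum_{k\in\mathcal{O}_r}c_k\Delta_{rk},\quad \gamma_{irt}(\lambda)=\frac{e^{u_{i0t}}}{e^{u_{irt}+\alpha_i(1-\lambda)\sigma_r}},\quad M^s_{irt}=\gamma_{irt}(0),\quad M^w_{ir}=\hat\Lambda\sigma_r .$$ $\mathcal{S}(\hat{\boldsymbol f},\hat\Lambda)$ is the set of $(\boldsymbol x,\boldsymbol s,\boldsymbol w,\boldsymbol p)$ with $x_a\in\{0,1\}$, $s_{irt},s_{i0t}\ge 0$, $w_{irt}\in\mathbb{R}$ ($i\in\mathcal{N},r\in\mathcal{R}_i,t\in\mathcal{T}$), $p_r\in\mathbb{R}$, satisfying - for $a\in\mathcal{A}$, $i\in\mathcal{N}_a$, $r\in\mathcal{R}_i\cap\mathcal{R}_a^D$, $t\in\mathcal{T}$: $s_{i0t}\le\gamma_{irt}(0)s_{irt}$; $s_{i0t}\ge\gamma_{irt}(0)s_{irt}-M^s_{irt}x_a$; $s_{i0t}\le\gamma_{irt}(\hat\Lambda)s_{irt}+M^s_{irt}(1-x_a)$; $s_{i0t}\ge\gamma_{irt}(\hat\Lambda)s_{irt}$; - for the same indices: $w_{irt}\le(\sigma_r-\kappa_r)s_{irt}$; $w_{irt}\ge(\sigma_r-\kappa_r)s_{irt}-M^w_{ir}x_a$;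 $w_{irt}\le((1-\hat\Lambda)\sigma_r-\kappa_r)s_{irt}+M^w_{ir}(1-x_a)$; $w_{irt}\ge((1-\hat\Lambda)\sigma_r-\kappa_r)s_{irt}$; - $s_{i0t}+\sum_{r\in\mathcal{R}_i}s_{irt}=1$ for $i\in\mathcal{N},t\in\mathcal{T}$; - $s_{i0t}=\gamma_{irt}(0)s_{irt}$ and $w_{irt}=(\sigma_r-\kappa_r)s_{irt}$ for $i\in\mathcal{N}$, $r\in\mathcal{R}_i\setminus\mathcal{R}^D$, $t\in\mathcal{T}$; - $p_r=\sigma_r$ for $r\in\mathcal{R}\setminus\mathcal{R}^D$, and $p_r=(1-\hat\Lambda x_a)\sigma_r$ for $a\in\mathcal{A}$, $r\in\mathcal{R}_a^D$. The second-stage value is $$W(\hat{\boldsymbol f},\hat\Lambda)=\max_{(\boldsymbol x,\boldsymbol s,\boldsymbol w,\boldsymbol p)\in\mathcal{S}(\hat{\boldsymbol f},\hat\Lambda)}\sum_{t\in\mathcal{T}}\sum_{i\in\mathcal{N}}N_{it}\Big(\pi^{PX}\big(u_{i0t}+\sum_{r\in\mathcal{R}_i}(u_{irt}+\alpha_ip_r)\big)+\pi^{PR}\sum_{r\in\mathcal{R}_i}w_{irt}-\pi^{VM}\Delta_i^0s_{i0t}\Big),$$ and PADP-FS2SD is the problem $\max\{W(\boldsymbol f,\Lambda):\boldsymbol f\in\mathcal{F},\ \Lambda\in\mathcal{L}\}$. The objective value of a tuple $(\boldsymbol f,\Lambda,\boldsymbol x,\boldsymbol s,\boldsymbol w,\boldsymbol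 p)$ with $(\boldsymbol x,\boldsymbol s,\boldsymbol w,\boldsymbol p)\in\mathcal{S}(\boldsymbol f,\Lambda)$ is the value of the sum being maximized in $W$. *)

theory Defs
  imports Complex_Main "HOL-Library.Extended_Real"
begin

text \<open>
  Instance data, over types of operators, routes, activation categories, passenger types and
  time intervals.  The index sets are explicit finite carriers inside these types; values of
  the data and of the decision variables outside the carriers are irrelevant.
\<close>

record ('o, 'r, 'a, 'n, 't) padp =
  operators :: "'o set"
  routes :: "'r set"
  categories :: "'a set"
  ptypes :: "'n set"
  times :: "'t set"
  route_ops :: "'r \<Rightarrow> 'o set"            \<comment> \<open>\<open>O\<^sub>r\<close>\<close>
  dist_op :: "'r \<Rightarrow> 'o \<Rightarrow> real"          \<comment> \<open>\<open>\<Delta>\<^sub>r\<^sub>k\<close>\<close>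
  mcost :: "'o \<Rightarrow> real"                \<comment> \<open>\<open>c\<^sub>k\<close>\<close>
  disc_routes :: "'r set"             \<comment> \<open>\<open>R\<^sup>D\<close>\<close>
  cat_routes :: "'a \<Rightarrow> 'r set"         \<comment> \<open>\<open>R\<^sup>D\<^sub>a\<close>\<close>
  options_of :: "'n \<Rightarrow> 'r set"         \<comment> \<open>\<open>R\<^sub>i\<close>\<close>
  npass :: "'n \<Rightarrow> 't \<Rightarrow> real"            \<comment> \<open>\<open>N\<^sub>i\<^sub>t\<close>\<close>
  util :: "'n \<Rightarrow> 'r \<Rightarrow> 't \<Rightarrow> real"         \<comment> \<open>\<open>u\<^sub>i\<^sub>r\<^sub>t\<close>\<close>
  util0 :: "'n \<Rightarrow> 't \<Rightarrow> real"            \<comment> \<open>\<open>u\<^sub>i\<^sub>0\<^sub>t\<close>\<close>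
  price_coeff :: "'n \<Rightarrow> real"          \<comment> \<open>\<open>\<alpha>\<^sub>i\<close>\<close>
  drive_dist :: "'n \<Rightarrow> real"           \<comment> \<open>\<open>\<Delta>\<^sup>0\<^sub>i\<close>\<close>
  wPX :: real
  wPR :: real
  wVM :: real
  base_max :: real                    \<comment> \<open>\<open>B\<close>\<close>
  markup_max :: real                  \<comment> \<open>\<open>M\<close>\<close>
  disc_max :: real                    \<comment> \<open>\<open>L\<close>\<close>

definition valid_padp :: "('o, 'r, 'a, 'n, 't) padp \<Rightarrow> bool" where
  "valid_padp D \<longleftrightarrow>
     finite (operators D) \<and> finite (routes D) \<and> finite (categories D) \<and>
     finite (ptypes D) \<and> finite (times D) \<and>
     (\<forall>r\<in>routes D. route_ops D r \<subseteq> operators D) \<and>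
     (\<forall>r\<in>routes D. \<forall>k\<in>route_ops D r. 0 \<le> dist_op D r k) \<and>
     (\<forall>k\<in>operators D. 0 \<le> mcost D k) \<and>
     disc_routes D \<subseteq> routes D \<and>
     disc_routes D = (\<Union>a\<in>categories D. cat_routes D a) \<and>
     (\<forall>a\<in>categories D. \<forall>b\<in>categories D. a \<noteq> b \<longrightarrow> cat_routes D a \<inter> cat_routes D b = {}) \<and>
     (\<forall>i\<in>ptypes D. options_of D i \<subseteq> routes D) \<and>
     (\<forall>i\<in>ptypes D. \<forall>t\<in>times D. 0 \<le> npass D i t) \<and>
     (\<forall>i\<in>ptypes D. price_coeff D i < 0) \<and>
     (\<forall>i\<in>ptypes D. 0 \<le> drive_dist D i) \<and>
     0 \<le> wPX D \<and> 0 \<le> wPR D \<and> 0 \<le> wVM D \<and>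
     0 \<le> base_max D \<and> 0 \<le> markup_max D \<and> 0 \<le> disc_max D \<and> disc_max D \<le> 1"

text \<open>Fare parameters are pairs (base fares, markups).\<close>

type_synonym 'o fares = "('o \<Rightarrow> real) \<times> ('o \<Rightarrow> real)"

definition fare_set :: "('o, 'r, 'a, 'n, 't) padp \<Rightarrow> 'o fares set" where
  "fare_set D = {(\<beta>, \<mu>). \<forall>k\<in>operators D.
     0 \<le> \<beta> k \<and> \<beta> k \<le> base_max D \<and> mcost D k \<le> \<mu> k \<and> \<mu> k \<le> markup_max D}"

definition disc_set :: "('o, 'r, 'a, 'n, 't) padp \<Rightarrow> real set" where
  "disc_set D = {0..disc_max D}"

definition cat_ptypes :: "('o, 'r, 'a, 'n, 't) padp \<Rightarrow> 'a \<Rightarrow> 'n set" where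
  "cat_ptypes D a = {i \<in> ptypes D. options_of D i \<inter> cat_routes D a \<noteq> {}}"

definition full_price :: "('o, 'r, 'a, 'n, 't) padp \<Rightarrow> 'o fares \<Rightarrow> 'r \<Rightarrow> real" where  \<comment> \<open>\<open>\<sigma>\<^sub>r\<close>\<close>
  "full_price D f r = (\<Sum>k\<in>route_ops D r. fst f k + snd f k * dist_op D r k)"

definition route_cost :: "('o, 'r, 'a, 'n, 't) padp \<Rightarrow> 'r \<Rightarrow> real" where  \<comment> \<open>\<open>\<kappa>\<^sub>r\<close>\<close>
  "route_cost D r = (\<Sum>k\<in>route_ops D r. mcost D k * dist_op D r k)"

definition pricing :: "('o, 'r, 'a, 'n, 't) padp \<Rightarrow> 'o fares \<Rightarrow> real \<Rightarrow>
    ('a \<Rightarrow> real) \<Rightarrow> ('r \<Rightarrow> real) \<Rightarrow> bool" where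
  "pricing D f \<Lambda> x p \<longleftrightarrow>
     (\<forall>r\<in>routes D - disc_routes D. p r = full_price D f r) \<and>
     (\<forall>a\<in>categories D. \<forall>r\<in>cat_routes D a. p r = (1 - \<Lambda> * x a) * full_price D f r)"

definition mnl_denom :: "('o, 'r, 'a, 'n, 't) padp \<Rightarrow> ('r \<Rightarrow> real) \<Rightarrow> 'n \<Rightarrow> 't \<Rightarrow> real" where
  "mnl_denom D p i t =
     exp (util0 D i t) + (\<Sum>q\<in>options_of D i. exp (util D i q t + price_coeff D i * p q))"

text \<open>Market shares are split into the route shares \<open>s i r t\<close> and the outside share \<open>s0 i t\<close>.\<close>

definition fs_feasible :: "('o, 'r, 'a, 'n, 't) padp \<Rightarrow> 'o fares \<Rightarrow> real \<Rightarrow> ('r \<Rightarrow> real) \<Rightarrow>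
    ('n \<Rightarrow> 'r \<Rightarrow> 't \<Rightarrow> real) \<Rightarrow> ('n \<Rightarrow> 't \<Rightarrow> real) \<Rightarrow> ('a \<Rightarrow> real) \<Rightarrow> bool" where
  "fs_feasible D f \<Lambda> p s s0 x \<longleftrightarrow>
     f \<in> fare_set D \<and> \<Lambda> \<in> disc_set D \<and> (\<forall>a\<in>categories D. x a \<in> {0, 1}) \<and>
     pricing D f \<Lambda> x p \<and>
     (\<forall>i\<in>ptypes D. \<forall>r\<in>options_of D i. \<forall>t\<in>times D.
        s i r t = exp (util D i r t + price_coeff D i * p r) / mnl_denom D p i t) \<and>
     (\<forall>i\<in>ptypes D. \<forall>t\<in>times D. s0 i t = exp (util0 D i t) / mnl_denom D p i t)"

definition fs_objective :: "('o, 'r, 'a, 'n, 't) padp \<Rightarrow> ('r \<Rightarrow> real) \<Rightarrow>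
    ('n \<Rightarrow> 'r \<Rightarrow> 't \<Rightarrow> real) \<Rightarrow> ('n \<Rightarrow> 't \<Rightarrow> real) \<Rightarrow> real" where
  "fs_objective D p s s0 = (\<Sum>t\<in>times D. \<Sum>i\<in>ptypes D. npass D i t *
     (wPX D * (util0 D i t + (\<Sum>r\<in>options_of D i. util D i r t + price_coeff D i * p r))
      + wPR D * (\<Sum>r\<in>options_of D i. (p r - route_cost D r) * s i r t)
      - wVM D * drive_dist D i * s0 i t))"

definition fs_optimal :: "('o, 'r, 'a, 'n, 't) padp \<Rightarrow> 'o fares \<Rightarrow> real \<Rightarrow> ('r \<Rightarrow> real) \<Rightarrow>
    ('n \<Rightarrow> 'r \<Rightarrow> 't \<Rightarrow> real) \<Rightarrow> ('n \<Rightarrow> 't \<Rightarrow> real) \<Rightarrow> ('a \<Rightarrow> real) \<Rightarrow> bool" where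
  "fs_optimal D f \<Lambda> p s s0 x \<longleftrightarrow> fs_feasible D f \<Lambda> p s s0 x \<and>
     (\<forall>f' \<Lambda>' p' s' s0' x'. fs_feasible D f' \<Lambda>' p' s' s0' x' \<longrightarrow>
        fs_objective D p' s' s0' \<le> fs_objective D p s s0)"

text \<open>Optimal values are taken in the extended reals, so that an infeasible problem
  (some \<open>c\<^sub>k > M\<close>) has value \<open>-\<infinity>\<close>.\<close>

definition fs_value :: "('o, 'r, 'a, 'n, 't) padp \<Rightarrow> ereal" where
  "fs_value D = Sup {ereal (fs_objective D p s s0) | f \<Lambda> p s s0 x. fs_feasible D f \<Lambda> p s s0 x}"

definition gam :: "('o, 'r, 'a, 'n, 't) padp \<Rightarrow> 'o fares \<Rightarrow> 'n \<Rightarrow> 'r \<Rightarrow> 't \<Rightarrow> real \<Rightarrow> real" where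
  "gam D f i r t l =
     exp (util0 D i t) / exp (util D i r t + price_coeff D i * (1 - l) * full_price D f r)"

definition bigM_s :: "('o, 'r, 'a, 'n, 't) padp \<Rightarrow> 'o fares \<Rightarrow> 'n \<Rightarrow> 'r \<Rightarrow> 't \<Rightarrow> real" where
  "bigM_s D f i r t = gam D f i r t 0"

definition bigM_w :: "('o, 'r, 'a, 'n, 't) padp \<Rightarrow> 'o fares \<Rightarrow> real \<Rightarrow> 'r \<Rightarrow> real" where
  "bigM_w D f \<Lambda> r = \<Lambda> * full_price D f r"

text \<open>\<open>ss_feasible D f \<Lambda> x s s0 w p\<close> is membership of \<open>(x, s, w, p)\<close> in the second-stage
  feasible set \<open>S(f, \<Lambda>)\<close>.\<close>

definition ss_feasible :: "('o, 'r, 'a, 'n, 't) padp \<Rightarrow> 'o fares \<Rightarrow> real \<Rightarrow> ('a \<Rightarrow> real) \<Rightarrow>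
    ('n \<Rightarrow> 'r \<Rightarrow> 't \<Rightarrow> real) \<Rightarrow> ('n \<Rightarrow> 't \<Rightarrow> real) \<Rightarrow> ('n \<Rightarrow> 'r \<Rightarrow> 't \<Rightarrow> real) \<Rightarrow> ('r \<Rightarrow> real) \<Rightarrow> bool" where
  "ss_feasible D f \<Lambda> x s s0 w p \<longleftrightarrow>
     (\<forall>a\<in>categories D. x a \<in> {0, 1}) \<and>
     (\<forall>i\<in>ptypes D. \<forall>t\<in>times D. 0 \<le> s0 i t) \<and>
     (\<forall>i\<in>ptypes D. \<forall>r\<in>options_of D i. \<forall>t\<in>times D. 0 \<le> s i r t) \<and>
     (\<forall>a\<in>categories D. \<forall>i\<in>cat_ptypes D a. \<forall>r\<in>options_of D i \<inter> cat_routes D a. \<forall>t\<in>times D.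
        s0 i t \<le> gam D f i r t 0 * s i r t \<and>
        s0 i t \<ge> gam D f i r t 0 * s i r t - bigM_s D f i r t * x a \<and>
        s0 i t \<le> gam D f i r t \<Lambda> * s i r t + bigM_s D f i r t * (1 - x a) \<and>
        s0 i t \<ge> gam D f i r t \<Lambda> * s i r t \<and>
        w i r t \<le> (full_price D f r - route_cost D r) * s i r t \<and>
        w i r t \<ge> (full_price D f r - route_cost D r) * s i r t - bigM_w D f \<Lambda> r * x a \<and>
        w i r t \<le> ((1 - \<Lambda>) * full_price D f r - route_cost D r) * s i r t
                    + bigM_w D f \<Lambda> r * (1 - x a) \<and>
        w i r t \<ge> ((1 - \<Lambda>) * full_price D f r - route_cost D r) * s i r t) \<and>
     (\<forall>i\<in>ptypes D. \<forall>t\<in>times D. s0 i t + (\<Sum>r\<in>options_of D i. s i r t) = 1) \<and>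
     (\<forall>i\<in>ptypes D. \<forall>r\<in>options_of D i - disc_routes D. \<forall>t\<in>times D.
        s0 i t = gam D f i r t 0 * s i r t \<and>
        w i r t = (full_price D f r - route_cost D r) * s i r t) \<and>
     pricing D f \<Lambda> x p"

definition ss_objective :: "('o, 'r, 'a, 'n, 't) padp \<Rightarrow> ('n \<Rightarrow> 't \<Rightarrow> real) \<Rightarrow>
    ('n \<Rightarrow> 'r \<Rightarrow> 't \<Rightarrow> real) \<Rightarrow> ('r \<Rightarrow> real) \<Rightarrow> real" where
  "ss_objective D s0 w p = (\<Sum>t\<in>times D. \<Sum>i\<in>ptypes D. npass D i t *
     (wPX D * (util0 D i t + (\<Sum>r\<in>options_of D i. util D i r t + price_coeff D i * p r))
      + wPR D * (\<Sum>r\<in>options_of D i. w i r t)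
      - wVM D * drive_dist D i * s0 i t))"

definition ss_optimal :: "('o, 'r, 'a, 'n, 't) padp \<Rightarrow> 'o fares \<Rightarrow> real \<Rightarrow> ('a \<Rightarrow> real) \<Rightarrow>
    ('n \<Rightarrow> 'r \<Rightarrow> 't \<Rightarrow> real) \<Rightarrow> ('n \<Rightarrow> 't \<Rightarrow> real) \<Rightarrow> ('n \<Rightarrow> 'r \<Rightarrow> 't \<Rightarrow> real) \<Rightarrow> ('r \<Rightarrow> real) \<Rightarrow> bool" where
  "ss_optimal D f \<Lambda> x s s0 w p \<longleftrightarrow> ss_feasible D f \<Lambda> x s s0 w p \<and>
     (\<forall>x' s' s0' w' p'. ss_feasible D f \<Lambda> x' s' s0' w' p' \<longrightarrow>
        ss_objective D s0' w' p' \<le> ss_objective D s0 w p)"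

definition ss_value :: "('o, 'r, 'a, 'n, 't) padp \<Rightarrow> 'o fares \<Rightarrow> real \<Rightarrow> ereal" where  \<comment> \<open>\<open>W(f, \<Lambda>)\<close>\<close>
  "ss_value D f \<Lambda> =
     Sup {ereal (ss_objective D s0 w p) | x s s0 w p. ss_feasible D f \<Lambda> x s s0 w p}"

definition fs2sd_feasible :: "('o, 'r, 'a, 'n, 't) padp \<Rightarrow> 'o fares \<Rightarrow> real \<Rightarrow> ('a \<Rightarrow> real) \<Rightarrow>
    ('n \<Rightarrow> 'r \<Rightarrow> 't \<Rightarrow> real) \<Rightarrow> ('n \<Rightarrow> 't \<Rightarrow> real) \<Rightarrow> ('n \<Rightarrow> 'r \<Rightarrow> 't \<Rightarrow> real) \<Rightarrow> ('r \<Rightarrow> real) \<Rightarrow> bool" where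
  "fs2sd_feasible D f \<Lambda> x s s0 w p \<longleftrightarrow>
     f \<in> fare_set D \<and> \<Lambda> \<in> disc_set D \<and> ss_feasible D f \<Lambda> x s s0 w p"

definition fs2sd_optimal :: "('o, 'r, 'a, 'n, 't) padp \<Rightarrow> 'o fares \<Rightarrow> real \<Rightarrow> ('a \<Rightarrow> real) \<Rightarrow>
    ('n \<Rightarrow> 'r \<Rightarrow> 't \<Rightarrow> real) \<Rightarrow> ('n \<Rightarrow> 't \<Rightarrow> real) \<Rightarrow> ('n \<Rightarrow> 'r \<Rightarrow> 't \<Rightarrow> real) \<Rightarrow> ('r \<Rightarrow> real) \<Rightarrow> bool" where
  "fs2sd_optimal D f \<Lambda> x s s0 w p \<longleftrightarrow>
     f \<in> fare_set D \<and> \<Lambda> \<in> disc_set D \<and>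
     (\<forall>f'\<in>fare_set D. \<forall>\<Lambda>'\<in>disc_set D. ss_value D f' \<Lambda>' \<le> ss_value D f \<Lambda>) \<and>
     ss_optimal D f \<Lambda> x s s0 w p"

definition fs2sd_value :: "('o, 'r, 'a, 'n, 't) padp \<Rightarrow> ereal" where
  "fs2sd_value D = (SUP f\<in>fare_set D. SUP \<Lambda>\<in>disc_set D. ss_value D f \<Lambda>)"

end

theory Submission
  imports Defs
begin

text \<open>
  For fixed \<open>(f, \<Lambda>)\<close> the two feasible sets coincide, with \<open>w\<^sub>i\<^sub>r\<^sub>t = (p\<^sub>r - \<kappa>\<^sub>r) s\<^sub>i\<^sub>r\<^sub>t\<close> forced.
  For binary \<open>x\<^sub>a\<close>, each group of four big-M inequalities selects one of two linear equations, and
  the two unselected inequalities are implied because \<open>0 \<le> s\<^sub>i\<^sub>r\<^sub>t \<le> 1\<close> and \<open>\<sigma>\<^sub>r \<ge> 0\<close>. The selected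
  share equations say that all shares are proportional to the exponentiated utilities at the
  prices actually charged; normalised to sum \<open>1\<close> they are the logit shares.
\<close>

section \<open>Big-M switching and logit normalisation\<close>

text \<open>At \<open>x = 0\<close> the first pair pins \<open>y\<close> to \<open>hi * s\<close>;
  at \<open>x = 1\<close> the second pair pins it to \<open>lo * s\<close>. The remaining pair then
  follows from \<open>0 \<le> (hi - lo) * s \<le> m\<close>.\<close>

lemma bigM_switch:
  fixes x s y lo hi m :: real
  assumes x: "x \<in> {0, 1}" and s: "0 \<le> s" "s \<le> 1" and "lo \<le> hi" "hi - lo \<le> m"
  shows "y \<le> hi * s \<and> y \<ge> hi * s - m * x \<and> y \<le> lo * s + m * (1 - x) \<and> y \<ge> lo * s
    \<longleftrightarrow> y = (if x = 0 then hi else lo) * s"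
proof -
  have "(hi - lo) * s \<le> m"
    using mult_left_le[of s "hi - lo"] assms by linarith
  moreover have "lo * s \<le> hi * s"
    using assms by (intro mult_right_mono)
  ultimately show ?thesis
    using x by (auto simp: left_diff_distrib)
qed

text \<open>The ratio equations make every share a multiple of \<open>exp (v r)\<close> with the
  common factor \<open>s0 / exp a\<close>; the total being \<open>1\<close> forces this factor to be
  \<open>1 / d\<close>.\<close>

lemma logit_shares_iff:
  fixes R :: "'r set" and v s :: "'r \<Rightarrow> real" and a s0 :: real
  defines "d \<equiv> exp a + (\<Sum>q\<in>R. exp (v q))"
  shows "s0 + sum s R = 1 \<and> (\<forall>r\<in>R. s0 = exp a / exp (v r) * s r)
    \<longleftrightarrow> s0 = exp a / d \<and> (\<forall>r\<in>R. s r = exp (v r) / d)"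
    (is "?L \<longleftrightarrow> ?R")
proof -
  have d: "d > 0"
    unfolding d_def by (intro add_pos_nonneg sum_nonneg) auto
  show ?thesis
  proof
    assume L: ?L
    have s: "s r = s0 / exp a * exp (v r)" if "r \<in> R" for r
    proof -
      have "s0 = exp a / exp (v r) * s r"
        using L that by blast
      then show ?thesis
        by (simp add: field_simps)
    qed
    have "sum s R = s0 / exp a * (\<Sum>r\<in>R. exp (v r))"
      by (simp add: s sum_distrib_left)
    then have "s0 / exp a * d = 1"
      using L by (simp add: d_def distrib_left)
    then have *: "s0 / exp a = 1 / d"
      using d by (subst nonzero_eq_divide_eq) auto
    then have "s0 = exp a / d"
      by (simp add: field_simps)
    with s * show ?R
      by simp
  next
    assume R: ?R
    then have "sum s R = (\<Sum>r\<in>R. exp (v r)) / d"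
      by (simp add: sum_divide_distrib)
    with R have "s0 + sum s R = (exp a + (\<Sum>r\<in>R. exp (v r))) / d"
      by (simp add: add_divide_distrib)
    with R d show ?L
      unfolding d_def[symmetric]
      by simp
  qed
qed

section \<open>Full prices, odds ratios and a single discounted route\<close>

lemma full_price_nonneg:
  assumes "valid_padp D" "f \<in> fare_set D" "r \<in> routes D"
  shows "0 \<le> full_price D f r"
  unfolding full_price_def
proof (intro sum_nonneg add_nonneg_nonneg mult_nonneg_nonneg)
  fix k assume k: "k \<in> route_ops D r"
  then have "k \<in> operators D"
    using assms by (auto simp: valid_padp_def)
  \<comment> \<open>The markup is at least \<open>mcost D k\<close>, which is nonnegative.\<close>
  then show "0 \<le> fst f k" "0 \<le> snd f k"
    using assms by (force simp: valid_padp_def fare_set_def)+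
  show "0 \<le> dist_op D r k"
    using assms k by (auto simp: valid_padp_def)
qed

text \<open>A deeper discount lowers the price; as the price coefficient is negative, this raises
  the exponent in the denominator of \<open>gam\<close>. It gives the ordering
  \<open>lo \<le> hi\<close> for the share constraints.\<close>

lemma gam_antimono:
  assumes "valid_padp D" "f \<in> fare_set D" "i \<in> ptypes D" "r \<in> routes D" "l \<le> l'"
  shows "gam D f i r t l' \<le> gam D f i r t l"
proof -
  have "price_coeff D i \<le> 0"
    using assms by (auto simp: valid_padp_def less_imp_le)
  then have "price_coeff D i * ((1 - l) * full_price D f r)
      \<le> price_coeff D i * ((1 - l') * full_price D f r)"
    using full_price_nonneg[of D f r] assms by (intro mult_left_mono_neg mult_right_mono) auto
  then show ?thesis
    by (simp add: gam_def mult.assoc divide_left_mono)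
qed

lemma gam_at_price:
  assumes "q = (1 - l) * full_price D f r"
  shows "gam D f i r t l = exp (util0 D i t) / exp (util D i r t + price_coeff D i * q)"
  by (simp add: gam_def assms mult.assoc)

lemma discount_block_iff:
  assumes D: "valid_padp D" and f: "f \<in> fare_set D" and l: "\<Lambda> \<in> disc_set D"
    and i: "i \<in> ptypes D" and r: "r \<in> routes D" and xa: "xa \<in> {0, 1}"
    and s: "0 \<le> s" "s \<le> 1" and q: "q = (1 - \<Lambda> * xa) * full_price D f r"
  shows "(y \<le> gam D f i r t 0 * s \<and> y \<ge> gam D f i r t 0 * s - bigM_s D f i r t * xa \<and>
      y \<le> gam D f i r t \<Lambda> * s + bigM_s D f i r t * (1 - xa) \<and> y \<ge> gam D f i r t \<Lambda> * s \<and>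
      z \<le> (full_price D f r - route_cost D r) * s \<and>
      z \<ge> (full_price D f r - route_cost D r) * s - bigM_w D f \<Lambda> r * xa \<and>
      z \<le> ((1 - \<Lambda>) * full_price D f r - route_cost D r) * s + bigM_w D f \<Lambda> r * (1 - xa) \<and>
      z \<ge> ((1 - \<Lambda>) * full_price D f r - route_cost D r) * s)
    \<longleftrightarrow> y = exp (util0 D i t) / exp (util D i r t + price_coeff D i * q) * s \<and>
        z = (q - route_cost D r) * s"
proof -
  have l0: "0 \<le> \<Lambda>"
    using l by (simp add: disc_set_def)
  have sg: "0 \<le> full_price D f r"
    using full_price_nonneg D f r .
  \<comment> \<open>The constant is \<open>gam\<close> at discount \<open>0\<close>, and subtracting
    a positive ratio only decreases it.\<close>
  have "gam D f i r t 0 - gam D f i r t \<Lambda> \<le> bigM_s D f i r t"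
    by (simp add: bigM_s_def gam_def)
  note shares = bigM_switch[OF xa s gam_antimono[OF D f i r l0] this, of y]
  have "(1 - \<Lambda>) * full_price D f r - route_cost D r \<le> full_price D f r - route_cost D r"
    using l0 sg by (simp add: left_diff_distrib)
  \<comment> \<open>Here the constant is exactly the gap between the two margins.\<close>
  moreover have "full_price D f r - route_cost D r - ((1 - \<Lambda>) * full_price D f r - route_cost D r)
      \<le> bigM_w D f \<Lambda> r"
    by (simp add: bigM_w_def left_diff_distrib)
  ultimately have revenues: "z \<le> (full_price D f r - route_cost D r) * s \<and>
      z \<ge> (full_price D f r - route_cost D r) * s - bigM_w D f \<Lambda> r * xa \<and>
      z \<le> ((1 - \<Lambda>) * full_price D f r - route_cost D r) * s + bigM_w D f \<Lambda> r * (1 - xa) \<and>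
      z \<ge> ((1 - \<Lambda>) * full_price D f r - route_cost D r) * s
    \<longleftrightarrow> z = (if xa = 0 then full_price D f r - route_cost D r
             else (1 - \<Lambda>) * full_price D f r - route_cost D r) * s"
    by (rule bigM_switch[OF xa s])
  \<comment> \<open>For binary \<open>xa\<close> both cases are one effective discount
    \<open>\<Lambda> * xa\<close>, the one defining \<open>q\<close>.\<close>
  have "(if xa = 0 then gam D f i r t 0 else gam D f i r t \<Lambda>) = gam D f i r t (\<Lambda> * xa)"
    using xa by auto
  also have "\<dots> = exp (util0 D i t) / exp (util D i r t + price_coeff D i * q)"
    using q by (rule gam_at_price)
  finally have g: "(if xa = 0 then gam D f i r t 0 else gam D f i r t \<Lambda>) = \<dots>" .
  have h: "(if xa = 0 then full_price D f r - route_cost D r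
      else (1 - \<Lambda>) * full_price D f r - route_cost D r) = q - route_cost D r"
    using xa q by auto
  show ?thesis
    using shares revenues unfolding g h by blast
qed

section \<open>Feasible solutions at fixed fares and discount\<close>

lemma ss_feasible_iff_fs_feasible:
  assumes D: "valid_padp D" and f: "f \<in> fare_set D" and l: "\<Lambda> \<in> disc_set D"
  shows "ss_feasible D f \<Lambda> x s s0 w p \<longleftrightarrow> fs_feasible D f \<Lambda> p s s0 x \<and>
    (\<forall>i\<in>ptypes D. \<forall>r\<in>options_of D i. \<forall>t\<in>times D. w i r t = (p r - route_cost D r) * s i r t)"
proof -
  define nonneg where "nonneg \<longleftrightarrow> (\<forall>i\<in>ptypes D. \<forall>t\<in>times D. 0 \<le> s0 i t) \<and>
    (\<forall>i\<in>ptypes D. \<forall>r\<in>options_of D i. \<forall>t\<in>times D. 0 \<le> s i r t)"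
  define total where "total \<longleftrightarrow>
    (\<forall>i\<in>ptypes D. \<forall>t\<in>times D. s0 i t + (\<Sum>r\<in>options_of D i. s i r t) = 1)"
  \<comment> \<open>The common form, at the price actually charged, to which both the discounted and
    the undiscounted constraints reduce.\<close>
  define linked where "linked i r t \<longleftrightarrow>
    s0 i t = exp (util0 D i t) / exp (util D i r t + price_coeff D i * p r) * s i r t \<and>
    w i r t = (p r - route_cost D r) * s i r t" for i r t
  have opt: "options_of D i \<subseteq> routes D" "finite (options_of D i)" if "i \<in> ptypes D" for i
    using D that finite_subset[of "options_of D i" "routes D"] by (auto simp: valid_padp_def)
  have cats: "disc_routes D = (\<Union>a\<in>categories D. cat_routes D a)"
    using D by (simp add: valid_padp_def)

  have linked_iff: "total \<and> (\<forall>i\<in>ptypes D. \<forall>r\<in>options_of D i. \<forall>t\<in>times D. linked i r t) \<longleftrightarrow>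
     (\<forall>i\<in>ptypes D. \<forall>r\<in>options_of D i. \<forall>t\<in>times D.
        s i r t = exp (util D i r t + price_coeff D i * p r) / mnl_denom D p i t) \<and>
     (\<forall>i\<in>ptypes D. \<forall>t\<in>times D. s0 i t = exp (util0 D i t) / mnl_denom D p i t) \<and>
     (\<forall>i\<in>ptypes D. \<forall>r\<in>options_of D i. \<forall>t\<in>times D. w i r t = (p r - route_cost D r) * s i r t)"
  proof -
    let ?v = "\<lambda>i r t. util D i r t + price_coeff D i * p r"
    let ?w = "\<forall>i\<in>ptypes D. \<forall>r\<in>options_of D i. \<forall>t\<in>times D.
      w i r t = (p r - route_cost D r) * s i r t"
    have "total \<and> (\<forall>i\<in>ptypes D. \<forall>r\<in>options_of D i. \<forall>t\<in>times D. linked i r t) \<longleftrightarrow>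
      (\<forall>i\<in>ptypes D. \<forall>t\<in>times D. s0 i t + (\<Sum>r\<in>options_of D i. s i r t) = 1 \<and>
        (\<forall>r\<in>options_of D i. s0 i t = exp (util0 D i t) / exp (?v i r t) * s i r t)) \<and> ?w"
      unfolding total_def linked_def by blast
    also have "\<dots> \<longleftrightarrow>
      (\<forall>i\<in>ptypes D. \<forall>t\<in>times D. s0 i t = exp (util0 D i t) / mnl_denom D p i t \<and>
        (\<forall>r\<in>options_of D i. s i r t = exp (?v i r t) / mnl_denom D p i t)) \<and> ?w"
      unfolding mnl_denom_def
      by (intro arg_cong2[of _ _ _ _ "(\<and>)"] ball_cong refl logit_shares_iff)
    finally show ?thesis
      by blast
  qed

  \<comment> \<open>Sign constraints are explicit only in the second stage; for logit shares they
    follow from the exponential formulas.\<close>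
  have nonneg_if: nonneg if "fs_feasible D f \<Lambda> p s s0 x"
  proof -
    have "0 \<le> mnl_denom D p i t" for i t
      unfolding mnl_denom_def by (intro add_nonneg_nonneg sum_nonneg) auto
    then show ?thesis
      using that by (simp add: nonneg_def fs_feasible_def)
  qed

  let ?block = "\<lambda>a i r t.
      s0 i t \<le> gam D f i r t 0 * s i r t \<and>
      s0 i t \<ge> gam D f i r t 0 * s i r t - bigM_s D f i r t * x a \<and>
      s0 i t \<le> gam D f i r t \<Lambda> * s i r t + bigM_s D f i r t * (1 - x a) \<and>
      s0 i t \<ge> gam D f i r t \<Lambda> * s i r t \<and>
      w i r t \<le> (full_price D f r - route_cost D r) * s i r t \<and>
      w i r t \<ge> (full_price D f r - route_cost D r) * s i r t - bigM_w D f \<Lambda> r * x a \<and>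
      w i r t \<le> ((1 - \<Lambda>) * full_price D f r - route_cost D r) * s i r t
                  + bigM_w D f \<Lambda> r * (1 - x a) \<and>
      w i r t \<ge> ((1 - \<Lambda>) * full_price D f r - route_cost D r) * s i r t"
  let ?plain = "\<lambda>i r t. s0 i t = gam D f i r t 0 * s i r t \<and>
      w i r t = (full_price D f r - route_cost D r) * s i r t"
  let ?blocks = "\<forall>a\<in>categories D. \<forall>i\<in>cat_ptypes D a.
    \<forall>r\<in>options_of D i \<inter> cat_routes D a. \<forall>t\<in>times D. ?block a i r t"
  let ?plains = "\<forall>i\<in>ptypes D. \<forall>r\<in>options_of D i - disc_routes D. \<forall>t\<in>times D. ?plain i r t"
  let ?x = "\<forall>a\<in>categories D. x a \<in> {0, 1}"
  let ?p = "pricing D f \<Lambda> x p"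
  let ?linked = "\<forall>i\<in>ptypes D. \<forall>r\<in>options_of D i. \<forall>t\<in>times D. linked i r t"
  \<comment> \<open>The first group supplies what the reduction of the second needs: binary
    activations, shares in \<open>[0, 1]\<close> and the charged prices. Hence
    \<open>blocks_iff\<close> is proved under that group and applied by
    \<open>conj_cong\<close>.\<close>
  have ss_unfold: "ss_feasible D f \<Lambda> x s s0 w p \<longleftrightarrow>
      (?x \<and> nonneg \<and> total \<and> ?p) \<and> (?blocks \<and> ?plains)"
    by (simp only: ss_feasible_def nonneg_def total_def conj_ac)

  have blocks_iff: "?blocks \<and> ?plains \<longleftrightarrow> ?linked"
    if x: ?x and nn: nonneg and tot: total and p: ?p
  proof -
    have s: "0 \<le> s i r t" "s i r t \<le> 1"
      if "i \<in> ptypes D" "r \<in> options_of D i" "t \<in> times D" for i r t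
    proof -
      show "0 \<le> s i r t"
        using nn that by (simp add: nonneg_def)
      \<comment> \<open>A single nonnegative share is bounded by the total, which is at most
        \<open>1\<close>.\<close>
      have "s i r t \<le> (\<Sum>r\<in>options_of D i. s i r t)"
        using nn that opt(2) by (intro member_le_sum) (auto simp: nonneg_def)
      moreover have "s0 i t + (\<Sum>r\<in>options_of D i. s i r t) = 1" "0 \<le> s0 i t"
        using tot nn that by (auto simp: total_def nonneg_def)
      ultimately show "s i r t \<le> 1"
        by linarith
    qed
    have block: "?block a i r t \<longleftrightarrow> linked i r t"
      if "a \<in> categories D" "i \<in> ptypes D" "r \<in> options_of D i" "r \<in> cat_routes D a" "t \<in> times D"
      for a i r t
      unfolding linked_def
      using that x p opt(1)
      by (intro discount_block_iff D f l s) (auto simp: pricing_def)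
    have plain: "?plain i r t \<longleftrightarrow> linked i r t"
      if "i \<in> ptypes D" "r \<in> options_of D i" "r \<notin> disc_routes D" for i r t
    proof -
      have "p r = full_price D f r"
        using that p opt(1) by (auto simp: pricing_def)
      then show ?thesis
        using gam_at_price[of "p r" 0 D f r i t] by (simp add: linked_def)
    qed
    have "?blocks \<and> ?plains \<longleftrightarrow>
       (\<forall>a\<in>categories D. \<forall>i\<in>cat_ptypes D a. \<forall>r\<in>options_of D i \<inter> cat_routes D a. \<forall>t\<in>times D.
          linked i r t) \<and>
       (\<forall>i\<in>ptypes D. \<forall>r\<in>options_of D i - disc_routes D. \<forall>t\<in>times D. linked i r t)"
      by (intro arg_cong2[of _ _ _ _ "(\<and>)"] ball_cong refl block plain)
        (auto simp: cat_ptypes_def)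
    \<comment> \<open>By \<open>cats\<close>, an option outside every category is outside
      \<open>disc_routes\<close>; an option of \<open>i\<close> inside category \<open>a\<close>
      itself witnesses that \<open>i\<close> lies in \<open>cat_ptypes D a\<close>. So the two
      ranges cover all options.\<close>
    also have "\<dots> \<longleftrightarrow> ?linked"
      unfolding cats cat_ptypes_def by blast
    finally show ?thesis .
  qed

  have fs_iff: "fs_feasible D f \<Lambda> p s s0 x \<and>
      (\<forall>i\<in>ptypes D. \<forall>r\<in>options_of D i. \<forall>t\<in>times D. w i r t = (p r - route_cost D r) * s i r t)
    \<longleftrightarrow> (?x \<and> nonneg \<and> total \<and> ?p) \<and> ?linked"
  proof -
    have "fs_feasible D f \<Lambda> p s s0 x \<and>
      (\<forall>i\<in>ptypes D. \<forall>r\<in>options_of D i. \<forall>t\<in>times D. w i r t = (p r - route_cost D r) * s i r t)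
      \<longleftrightarrow> ?x \<and> ?p \<and> total \<and> ?linked"
      unfolding linked_iff using f l by (simp add: fs_feasible_def conj_ac)
    with nonneg_if show ?thesis
      by argo
  qed
  show ?thesis
    unfolding ss_unfold fs_iff using blocks_iff by (intro conj_cong refl) auto
qed

section \<open>Objectives and optimal values\<close>

lemma ss_objective_eq_fs_objective:
  assumes "\<forall>i\<in>ptypes D. \<forall>r\<in>options_of D i. \<forall>t\<in>times D.
    w i r t = (p r - route_cost D r) * s i r t"
  shows "ss_objective D s0 w p = fs_objective D p s s0"
  using assms by (simp add: ss_objective_def fs_objective_def)

lemma fs_feasible_imp_ss_feasible:
  assumes "valid_padp D" "fs_feasible D f \<Lambda> p s s0 x"
  shows "ss_feasible D f \<Lambda> x s s0 (\<lambda>i r t. (p r - route_cost D r) * s i r t) p"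
  using assms ss_feasible_iff_fs_feasible[OF assms(1)] by (auto simp: fs_feasible_def)

text \<open>Each feasible point of one problem has a counterpart of equal objective in the other, so
  the suprema bound each other. Empty feasible sets, of value \<open>-\<infinity>\<close>, are
  covered too.\<close>

lemma fs_value_eq_fs2sd_value:
  assumes D: "valid_padp D"
  shows "fs_value D = fs2sd_value D"
proof (rule antisym)
  show "fs_value D \<le> fs2sd_value D"
    unfolding fs_value_def
  proof (rule Sup_least, clarify)
    fix f \<Lambda> p s s0 x
    assume fs: "fs_feasible D f \<Lambda> p s s0 x"
    let ?w = "\<lambda>i r t. (p r - route_cost D r) * s i r t"
    have "ereal (fs_objective D p s s0) = ereal (ss_objective D s0 ?w p)"
      by (simp add: ss_objective_eq_fs_objective[where s = s])
    also have "\<dots> \<le> ss_value D f \<Lambda>"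
      unfolding ss_value_def using fs_feasible_imp_ss_feasible[OF D fs] by (blast intro: Sup_upper)
    also have "\<dots> \<le> fs2sd_value D"
      unfolding fs2sd_value_def using fs
      by (intro SUP_upper2[of f] SUP_upper) (auto simp: fs_feasible_def)
    finally show "ereal (fs_objective D p s s0) \<le> fs2sd_value D" .
  qed
  show "fs2sd_value D \<le> fs_value D"
    unfolding fs2sd_value_def ss_value_def
  proof (intro SUP_least Sup_least, clarify)
    fix f \<Lambda> x s s0 w p
    assume "f \<in> fare_set D" "\<Lambda> \<in> disc_set D" "ss_feasible D f \<Lambda> x s s0 w p"
    then have "fs_feasible D f \<Lambda> p s s0 x" "ss_objective D s0 w p = fs_objective D p s s0"
      by (simp_all add: ss_feasible_iff_fs_feasible[OF D] ss_objective_eq_fs_objective[where s = s])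
    moreover from this have "ereal (fs_objective D p s s0) \<le> fs_value D"
      unfolding fs_value_def by (blast intro: Sup_upper)
    ultimately show "ereal (ss_objective D s0 w p) \<le> fs_value D"
      by simp
  qed
qed

theorem lemma1:
  fixes D :: "('o, 'r, 'a, 'n, 't) padp"
  assumes "valid_padp D"
  shows
    "(\<forall>f \<Lambda> p s s0 x. fs_optimal D f \<Lambda> p s s0 x \<longrightarrow>
        (\<exists>w. fs2sd_feasible D f \<Lambda> x s s0 w p \<and> ss_objective D s0 w p = fs_objective D p s s0))
     \<and> (\<forall>f \<Lambda> x s s0 w p. fs2sd_optimal D f \<Lambda> x s s0 w p \<longrightarrow>
          fs_feasible D f \<Lambda> p s s0 x \<and> fs_objective D p s s0 = ss_objective D s0 w p)
     \<and> fs_value D = fs2sd_value D"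
proof (intro conjI allI impI)
  fix f \<Lambda> p s s0 x
  assume "fs_optimal D f \<Lambda> p s s0 x"
  then have "fs_feasible D f \<Lambda> p s s0 x"
    by (simp add: fs_optimal_def)
  \<comment> \<open>The witness is margin times share, turning the linear revenue term back into the
    nonlinear one.\<close>
  then show "\<exists>w. fs2sd_feasible D f \<Lambda> x s s0 w p \<and> ss_objective D s0 w p = fs_objective D p s s0"
    using fs_feasible_imp_ss_feasible[OF assms]
    by (intro exI[of _ "\<lambda>i r t. (p r - route_cost D r) * s i r t"])
      (auto simp: fs2sd_feasible_def fs_feasible_def ss_objective_eq_fs_objective[where s = s])
next
  fix f \<Lambda> x s s0 w p
  assume "fs2sd_optimal D f \<Lambda> x s s0 w p"
  then have "f \<in> fare_set D" "\<Lambda> \<in> disc_set D" "ss_feasible D f \<Lambda> x s s0 w p"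
    by (simp_all add: fs2sd_optimal_def ss_optimal_def)
  then show "fs_feasible D f \<Lambda> p s s0 x" "fs_objective D p s s0 = ss_objective D s0 w p"
    by (simp_all add: ss_feasible_iff_fs_feasible[OF assms]
        ss_objective_eq_fs_objective[where s = s])
qed (rule fs_value_eq_fs2sd_value[OF assms])

end
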